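(* Let $n \ge 3$, $2 \le k \le n-1$ and $c \ge 1$ be integers, let $G = T(n,k^{(c)})$ and $t(v_i) = t(G, v_i, v_n)$. Then \[ t(v_i) = \begin{cases} n^2 - k^2 + 2(c-1)(n-k) + (k-1)^2 - (i-1)^2, & 1 \le i \le k-1,\\ n^2 - i^2 + 2(c-1)(n-i), & k \le i \le n-1. \end{cases} \]
   Context: $T(n,k^{(c)})$ is the tree consisting of a path (spine) $v_1 v_2 \cdots v_n$ together with a path $u_1 u_2 \cdots u_c$ of $c$ further vertices, where $u_c$ is adjacent to $v_k$ and $d(u_1)=1$ (so $u_1,\ldots,u_c$ form a pendant path hanging from $v_k$). $t(G,v,u)$ denotes the expected number of steps until a simple random walk on $G$ started at $v$ (moving each step to a uniformly random neighbor) first reaches $u$. *)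

theory Defs
  imports "HOL-Probability.Probability"
begin

text \<open>A graph is given by its vertex set and its set of (undirected, two-element) edges.\<close>

type_synonym 'a graph = "'a set \<times> 'a set set"

definition finite_simple_graph :: "'a graph \<Rightarrow> bool" where
  "finite_simple_graph G \<longleftrightarrow> finite (fst G) \<and> (\<forall>e\<in>snd G. e \<subseteq> fst G \<and> card e = 2)"

definition neighbors :: "'a graph \<Rightarrow> 'a \<Rightarrow> 'a set" where
  "neighbors G x = {y \<in> fst G. {x, y} \<in> snd G}"

text \<open>
  The transition law from \<open>x\<close> is uniform on the neighbors of \<open>x\<close>. It is meaningful only if
  \<open>neighbors G x\<close> is finite and nonempty (otherwise it is an unspecified distribution).
\<close>

definition srw_step :: "'a graph \<Rightarrow> 'a \<Rightarrow> 'a pmf" where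
  "srw_step G x = pmf_of_set (neighbors G x)"

text \<open>
  Transition kernels in the sense of the Ionescu-Tulcea theorem: the law of the position at
  time \<open>n\<close>, given the trajectory \<open>\<omega>\<close> restricted to the times \<open>0, \<dots>, n - 1\<close>.
\<close>

primrec srw_kernel :: "'a graph \<Rightarrow> 'a \<Rightarrow> nat \<Rightarrow> (nat \<Rightarrow> 'a) \<Rightarrow> 'a measure" where
  "srw_kernel G v 0 \<omega> = measure_pmf (return_pmf v)"
| "srw_kernel G v (Suc n) \<omega> = measure_pmf (srw_step G (\<omega> n))"

lemma Ionescu_Tulcea_srw:
  fixes G :: "'a graph"
  shows "Ionescu_Tulcea (srw_kernel G v) (\<lambda>_. count_space UNIV)"
proof (rule Ionescu_Tulcea.intro)
  show "srw_kernel G v i \<in> measurable (PiM {0..<i} (\<lambda>_. count_space UNIV))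
      (subprob_algebra (count_space UNIV))" for i
  proof (cases i)
    case 0
    have "(\<lambda>\<omega>::nat \<Rightarrow> 'a. measure_pmf (return_pmf v)) \<in>
        measurable (PiM {0..<i} (\<lambda>_. count_space UNIV)) (subprob_algebra (count_space UNIV))"
      by (intro measurable_const measure_pmf_in_subprob_algebra)
    also have "(\<lambda>\<omega>::nat \<Rightarrow> 'a. measure_pmf (return_pmf v)) = srw_kernel G v i"
      using 0 by (auto simp: fun_eq_iff)
    finally show ?thesis .
  next
    case (Suc n)
    have "(\<lambda>\<omega>::nat \<Rightarrow> 'a. measure_pmf (srw_step G (\<omega> n))) \<in>
        measurable (PiM {0..<i} (\<lambda>_. count_space UNIV)) (subprob_algebra (count_space UNIV))"
    proof (rule measurable_compose[where f = "\<lambda>\<omega>. \<omega> n" and N = "count_space UNIV"])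
      show "(\<lambda>\<omega>::nat \<Rightarrow> 'a. \<omega> n) \<in>
          measurable (PiM {0..<i} (\<lambda>_. count_space UNIV)) (count_space UNIV)"
        using Suc by (intro measurable_component_singleton) auto
      show "(\<lambda>x. measure_pmf (srw_step G x)) \<in>
          measurable (count_space UNIV) (subprob_algebra (count_space UNIV))"
        by (auto intro: measure_pmf_in_subprob_algebra)
    qed
    also have "(\<lambda>\<omega>::nat \<Rightarrow> 'a. measure_pmf (srw_step G (\<omega> n))) = srw_kernel G v i"
      using Suc by (auto simp: fun_eq_iff)
    finally show ?thesis .
  qed
  show "prob_space (srw_kernel G v i x)" for i x
    by (cases i) (auto intro: measure_pmf.prob_space_axioms)
qed

text \<open>The law, on trajectories \<open>nat \<Rightarrow> 'a\<close>, of the simple random walk on \<open>G\<close> started at \<open>v\<close>.\<close>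

definition srw :: "'a graph \<Rightarrow> 'a \<Rightarrow> (nat \<Rightarrow> 'a) measure" where
  "srw G v = projective_family.lim UNIV
     (Ionescu_Tulcea.CI (srw_kernel G v) (\<lambda>_. count_space UNIV)) (\<lambda>_. count_space UNIV)"

lemma prob_space_srw: "prob_space (srw G v)"
proof -
  interpret IT: Ionescu_Tulcea "srw_kernel G v" "\<lambda>_. count_space UNIV"
    by (rule Ionescu_Tulcea_srw)
  have "emeasure IT.PF.lim (IT.PF.emb UNIV {} {\<lambda>x. undefined}) = emeasure (IT.CI {}) {\<lambda>x. undefined}"
    by (rule IT.lim) (auto simp: PiM_empty)
  moreover have "IT.PF.emb UNIV {} {\<lambda>x. undefined} = space IT.PF.lim"
    by (auto simp: prod_emb_def space_PiM restrict_def)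
  moreover have "prob_space (IT.CI {})" by (rule IT.PF.prob_space_P) auto
  then have "emeasure (IT.CI {}) (space (IT.CI {})) = 1" by (rule prob_space.emeasure_space_1)
  moreover have "space (IT.CI {}) = {\<lambda>x. undefined}" by (auto simp: IT.CI_def space_PiM)
  ultimately show ?thesis unfolding srw_def by (intro prob_spaceI) simp
qed

lemma sets_srw: "sets (srw G v) = sets (PiM UNIV (\<lambda>_. count_space UNIV))"
proof -
  interpret IT: Ionescu_Tulcea "srw_kernel G v" "\<lambda>_. count_space UNIV"
    by (rule Ionescu_Tulcea_srw)
  show ?thesis unfolding srw_def by simp
qed

lemma emeasure_srw_cylinder:
  fixes G :: "'a graph"
  shows "emeasure (srw G v) {\<omega>. \<forall>i\<le>m. \<omega> i = x i} =
     indicator {v} (x 0) * (\<Prod>i<m. ennreal (pmf (srw_step G (x i)) (x (Suc i))))"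
proof -
  interpret IT: Ionescu_Tulcea "srw_kernel G v" "\<lambda>_. count_space UNIV"
    by (rule Ionescu_Tulcea_srw)
  let ?M = "\<lambda>_::nat. count_space (UNIV :: 'a set)"
  let ?X = "\<lambda>n. {restrict x {0..<n}}"
  let ?u = "\<lambda>_::nat. undefined :: 'a"
  have X: "?X n = PiE {0..<n} (\<lambda>i. {x i})" for n
    by (auto simp: PiE_iff extensional_def fun_eq_iff restrict_def)
  have sX: "?X n \<in> sets (PiM {0..<n} ?M)" for n
    unfolding X by (intro sets_PiM_I_finite) auto
  have u: "?u \<in> space (PiM {0..<0} ?M)" by (auto simp: space_PiM)
  have step: "emeasure (IT.C 0 (Suc n) ?u) (?X (Suc n)) =
      emeasure (IT.C 0 n ?u) (?X n) *
      emeasure (srw_kernel G v n (restrict x {0..<n})) {x n}" for n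
  proof -
    let ?c = "emeasure (srw_kernel G v n (restrict x {0..<n})) {x n}"
    have "emeasure (IT.C 0 (Suc n) ?u) (?X (Suc n)) =
        (\<integral>\<^sup>+\<omega>. emeasure (IT.eP n \<omega>) (?X (Suc n)) \<partial>IT.C 0 n ?u)"
      using sX[of "Suc n"] u IT.measurable_eP[of n] IT.space_C[OF u, of n] IT.sets_C[OF u, of n]
      by (simp, subst emeasure_bind[where N = "PiM {0..<Suc n} ?M"])
         (auto simp: measurable_cong_sets[OF IT.sets_C[OF u, of n] refl] space_PiM)
    also have "\<dots> = (\<integral>\<^sup>+\<omega>. ?c * indicator (?X n) \<omega> \<partial>IT.C 0 n ?u)"
    proof (rule nn_integral_cong)
      fix \<omega> assume "\<omega> \<in> space (IT.C 0 n ?u)"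
      then have \<omega>: "\<omega> \<in> space (PiM {0..<n} ?M)" using IT.space_C[OF u, of n] by simp
      then have ext: "\<omega> i = undefined" if "i \<ge> n" for i
        using that by (auto simp: space_PiM PiE_iff extensional_def)
      have upd: "fun_upd \<omega> n y = restrict x {0..<Suc n} \<longleftrightarrow> \<omega> = restrict x {0..<n} \<and> y = x n" for y
        using ext by (auto simp: fun_eq_iff restrict_def)
      have "emeasure (IT.eP n \<omega>) (?X (Suc n)) =
          emeasure (srw_kernel G v n \<omega>) ((\<lambda>y. fun_upd \<omega> n y) -` ?X (Suc n) \<inter> UNIV)"
        using IT.emeasure_eP[OF \<omega> sX] by simp
      also have "(\<lambda>y. fun_upd \<omega> n y) -` ?X (Suc n) \<inter> UNIV =
          (if \<omega> = restrict x {0..<n} then {x n} else {})"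
        using upd by auto
      finally show "emeasure (IT.eP n \<omega>) (?X (Suc n)) = ?c * indicator (?X n) \<omega>"
        by (cases "\<omega> = restrict x {0..<n}") (simp_all del: restrict_apply)
    qed
    also have "\<dots> = emeasure (IT.C 0 n ?u) (?X n) * ?c"
      using sX[of n] IT.sets_C[OF u, of n]
      by (subst nn_integral_cmult_indicator) (auto simp: mult.commute)
    finally show ?thesis .
  qed
  have C: "emeasure (IT.C 0 (Suc n) ?u) (?X (Suc n)) =
      indicator {v} (x 0) * (\<Prod>i<n. ennreal (pmf (srw_step G (x i)) (x (Suc i))))" for n
  proof (induction n)
    case 0
    have C0: "emeasure (IT.C 0 0 ?u) (?X 0) = 1"
      using sX[of 0] by (simp add: restrict_def)
    show ?case
      unfolding step[of 0] C0 by (simp add: emeasure_pmf_single indicator_def)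
  next
    case (Suc n)
    show ?case
      unfolding step[of "Suc n"] Suc.IH
      by (simp add: emeasure_pmf_single mult.assoc)
  qed
  have "{\<omega>. \<forall>i\<le>m. \<omega> i = x i} = IT.PF.emb UNIV {0..<Suc m} (?X (Suc m))"
    by (auto simp: prod_emb_def space_PiM fun_eq_iff restrict_def less_Suc_eq_le) metis
  then have "emeasure (srw G v) {\<omega>. \<forall>i\<le>m. \<omega> i = x i} = emeasure (IT.CI {0..<Suc m}) (?X (Suc m))"
    unfolding srw_def using IT.lim[OF _ sX, of "Suc m"] by simp
  also have "\<dots> = emeasure (IT.C 0 (Suc m) ?u) (?X (Suc m))"
    using IT.emeasure_CI[of "{0..<Suc m}" "Suc m", OF _ sX] sX[of "Suc m"]
    by (simp add: prod_emb_id[OF sets.sets_into_space[OF sX, unfolded space_PiM]] del: IT.C.simps)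
  finally show ?thesis using C[of m] by simp
qed

text \<open>The infimum of the empty set is \<open>\<infinity>\<close>: trajectories that never visit \<open>u\<close> have hitting time \<open>\<infinity>\<close>.\<close>

definition hitting_time :: "'a \<Rightarrow> (nat \<Rightarrow> 'a) \<Rightarrow> enat" where
  "hitting_time u \<omega> = Inf (enat ` {n. \<omega> n = u})"

definition expected_hitting_time :: "'a graph \<Rightarrow> 'a \<Rightarrow> 'a \<Rightarrow> ennreal" where
  "expected_hitting_time G v u = (\<integral>\<^sup>+\<omega>. ennreal_of_enat (hitting_time u \<omega>) \<partial>srw G v)"

lemma measurable_hitting_time:
  "(\<lambda>\<omega>. ennreal_of_enat (hitting_time u \<omega>)) \<in> borel_measurable (srw G v)"
proof -
  have [measurable]: "(\<lambda>\<omega>. \<omega> n) \<in> measurable (srw G v) (count_space UNIV)" for n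
    by (subst measurable_cong_sets[OF sets_srw refl]) (rule measurable_component_singleton, simp)
  have "hitting_time u \<omega> = (INF n. if \<omega> n = u then enat n else \<infinity>)" for \<omega>
    unfolding hitting_time_def
    by (rule antisym) (auto intro!: Inf_greatest INF_greatest intro: Inf_lower INF_lower2)
  then have "hitting_time u = (\<lambda>\<omega>. INF n. if \<omega> n = u then enat n else \<infinity>)" by auto
  moreover have "(\<lambda>\<omega>. INF n. if \<omega> n = u then enat n else \<infinity>) \<in> measurable (srw G v) (count_space UNIV)"
    by measurable
  ultimately show ?thesis by simp
qed

text \<open>\<open>V i\<close> is the spine vertex \<open>v\<^sub>i\<close>, \<open>U j\<close> the vertex \<open>u\<^sub>j\<close> of the pendant path.\<close>

datatype vertex = V nat | U nat

definition pendant_path_tree :: "nat \<Rightarrow> nat \<Rightarrow> nat \<Rightarrow> vertex graph" where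
  "pendant_path_tree n k c =
     (V ` {1..n} \<union> U ` {1..c},
      {{V i, V (i + 1)} | i. 1 \<le> i \<and> i < n} \<union>
      {{U j, U (j + 1)} | j. 1 \<le> j \<and> j < c} \<union>
      {{U c, V k}})"

lemma finite_simple_graph_pendant_path_tree:
  assumes "1 \<le> k" "k \<le> n" "1 \<le> c"
  shows "finite_simple_graph (pendant_path_tree n k c)"
  using assms by (auto simp: finite_simple_graph_def pendant_path_tree_def)

end

theory Submission
  imports Defs
begin

text \<open>
  Killing the walk when it leaves a set \<open>S\<close> of vertices gives a substochastic operator \<open>L\<close>, and the
  probability of survival up to time \<open>m\<close> is \<open>(L ^ m) 1\<close>. If \<open>h\<close> vanishes at the target and satisfies
  \<open>h = 1 + L h\<close> on the other vertices, then \<open>h = (\<Sum>j<m. (L ^ j) 1) + (L ^ m) h\<close>. So the survival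
  probabilities are summable, hence tend to \<open>0\<close>; since \<open>h\<close> is bounded, so does \<open>(L ^ m) h\<close>, and the
  expected hitting time \<open>\<Sum>j. (L ^ j) 1\<close> equals \<open>h\<close>. On the tree, \<open>h\<close> at the vertices of the pendant
  path is found from the fact that crossing an edge takes \<open>2 * m + 1\<close> steps on average if \<open>m\<close> edges
  lie behind it.
\<close>

section \<open>The killed operator and its expansion over paths\<close>

definition killed_step :: "'a graph \<Rightarrow> 'a set \<Rightarrow> ('a \<Rightarrow> real) \<Rightarrow> 'a \<Rightarrow> real" where
  "killed_step G S g x = (\<Sum>y\<in>S. pmf (srw_step G x) y * g y)"

lemma killed_step_mono:
  assumes "\<And>y. y \<in> S \<Longrightarrow> f y \<le> g y"
  shows "killed_step G S f x \<le> killed_step G S g x"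
  unfolding killed_step_def by (intro sum_mono mult_left_mono assms) auto

lemma killed_step_cong:
  assumes "\<And>y. y \<in> S \<Longrightarrow> f y = g y"
  shows "killed_step G S f x = killed_step G S g x"
  unfolding killed_step_def using assms by (intro sum.cong) auto

lemma killed_step_add:
  "killed_step G S (\<lambda>y. f y + g y) x = killed_step G S f x + killed_step G S g x"
  by (simp add: killed_step_def algebra_simps sum.distrib)

lemma killed_step_scale: "killed_step G S (\<lambda>y. a * f y) x = a * killed_step G S f x"
  by (simp add: killed_step_def sum_distrib_left mult_ac)

lemma killed_step_sum:
  "killed_step G S (\<lambda>y. \<Sum>j\<in>J. f j y) x = (\<Sum>j\<in>J. killed_step G S (f j) x)"
  unfolding killed_step_def by (simp add: sum_distrib_left sum.swap[of _ J])

lemma killed_step_pow_nonneg: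
  assumes "x \<in> S" "\<And>y. y \<in> S \<Longrightarrow> 0 \<le> f y"
  shows "0 \<le> (killed_step G S ^^ m) f x"
  using assms(1)
proof (induction m arbitrary: x)
  case (Suc m)
  then show ?case by (auto simp: killed_step_def intro!: sum_nonneg)
qed (use assms(2) in simp)

text \<open>The weights are nonnegative, so the operator preserves order. This dominates the
  remainder \<open>(L ^ m) h\<close> by a multiple of the survival probability.\<close>

lemma killed_step_pow_le:
  assumes "x \<in> S" "\<And>y. y \<in> S \<Longrightarrow> f y \<le> C"
  shows "(killed_step G S ^^ m) f x \<le> C * (killed_step G S ^^ m) (\<lambda>_. 1) x"
  using assms(1)
proof (induction m arbitrary: x)
  case (Suc m)
  have "killed_step G S ((killed_step G S ^^ m) f) x
      \<le> killed_step G S (\<lambda>y. C * (killed_step G S ^^ m) (\<lambda>_. 1) y) x"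
    by (rule killed_step_mono) (rule Suc.IH)
  then show ?case by (simp add: killed_step_scale)
qed (use assms(2) in simp)

text \<open>Induction peels off the last step and absorbs it into the arbitrary weight
  \<open>g\<close>, which becomes \<open>killed_step G S g\<close>. The factor
  \<open>indicator S v\<close> appears because \<open>killed_step\<close> tests only arrival
  vertices, not the start.\<close>

lemma sum_paths_killed_step_pow:
  assumes "finite S"
  shows "(\<Sum>x\<in>{..m} \<rightarrow>\<^sub>E S. indicator {v} (x 0) *
            (\<Prod>i<m. pmf (srw_step G (x i)) (x (Suc i))) * g (x m)) =
         indicator S v * (killed_step G S ^^ m) g v"
proof (induction m arbitrary: g)
  case 0
  have eq: "{..0::nat} \<rightarrow>\<^sub>E S = (\<lambda>a. (\<lambda>_. undefined)(0 := a)) ` S"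
    using PiE_insert_eq[of "0::nat" "{}" "\<lambda>_. S"] by (auto simp: image_iff)
  have inj: "inj_on (\<lambda>a. (\<lambda>_::nat. undefined)(0 := a)) S"
    by (intro inj_onI) (metis fun_upd_same)
  have "(\<Sum>a\<in>S. indicator {v} a * g a) = indicator S v * g v"
    using assms by (simp add: indicator_def if_distrib[of "\<lambda>x. x * _"])
  then show ?case unfolding eq by (simp add: sum.reindex[OF inj] del: One_nat_def)
next
  case (Suc m)
  let ?w = "\<lambda>x. indicator {v} (x 0) * (\<Prod>i<m. pmf (srw_step G (x i)) (x (Suc i)))"
  let ?ext = "\<lambda>(y, x). x(Suc m := y)"
  have eq: "{..Suc m} \<rightarrow>\<^sub>E S = ?ext ` (S \<times> ({..m} \<rightarrow>\<^sub>E S))"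
    by (simp add: atMost_Suc PiE_insert_eq)
  have inj: "inj_on ?ext (S \<times> ({..m} \<rightarrow>\<^sub>E S))"
    using inj_combinator[of "Suc m" "{..m}" "\<lambda>_. S"] by simp
  \<comment> \<open>\<open>?w\<close> reads only the coordinates up to \<open>m\<close>, so the new
    endpoint does not affect it.\<close>
  have w: "?w (x(Suc m := y)) = ?w x" for x y
    by (intro arg_cong2[where f = "(*)"] prod.cong) auto
  have "(\<Sum>x\<in>{..Suc m} \<rightarrow>\<^sub>E S. indicator {v} (x 0) *
            (\<Prod>i<Suc m. pmf (srw_step G (x i)) (x (Suc i))) * g (x (Suc m)))
      = (\<Sum>x\<in>{..Suc m} \<rightarrow>\<^sub>E S. ?w x * (pmf (srw_step G (x m)) (x (Suc m)) * g (x (Suc m))))"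
    by (simp add: mult.assoc)
  also have "\<dots> = (\<Sum>(y, x)\<in>S \<times> ({..m} \<rightarrow>\<^sub>E S). ?w x * (pmf (srw_step G (x m)) y * g y))"
    unfolding eq sum.reindex[OF inj] by (intro sum.cong refl) (simp only: o_def case_prod_beta w, simp)
  also have "\<dots> = (\<Sum>x\<in>{..m} \<rightarrow>\<^sub>E S. ?w x * killed_step G S g (x m))"
    unfolding sum.cartesian_product[symmetric]
    by (subst sum.swap) (simp add: killed_step_def sum_distrib_left)
  also have "\<dots> = indicator S v * (killed_step G S ^^ m) (killed_step G S g) v"
    by (rule Suc.IH)
  finally show ?case by (simp add: funpow_swap1)
qed

section \<open>Law of the walk: survival probabilities and one-step averages\<close>

lemma measurable_srw_coordinate [measurable]:
  "(\<lambda>\<omega>. \<omega> n) \<in> measurable (srw G v) (count_space UNIV)"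
  by (subst measurable_cong_sets[OF sets_srw refl]) (rule measurable_component_singleton, simp)

lemma space_srw [simp]: "space (srw G v) = UNIV"
  using sets_eq_imp_space_eq[OF sets_srw] by (simp add: space_PiM)

lemma sets_srw_stays: "{\<omega>. \<forall>i\<le>(m::nat). \<omega> i \<in> S} \<in> sets (srw G v)"
proof -
  have "(\<lambda>\<omega>. \<omega> i) -` S \<inter> space (srw G v) \<in> sets (srw G v)" for i
    by (rule measurable_sets[OF measurable_srw_coordinate]) simp
  then have "(\<Inter>i\<in>{..m}. (\<lambda>\<omega>. \<omega> i) -` S \<inter> space (srw G v)) \<in> sets (srw G v)"
    by (intro sets.finite_INT) auto
  also have "(\<Inter>i\<in>{..m}. (\<lambda>\<omega>. \<omega> i) -` S \<inter> space (srw G v)) = {\<omega>. \<forall>i\<le>m. \<omega> i \<in> S}"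
    by auto
  finally show ?thesis .
qed

text \<open>The event is a finite disjoint union of cylinders, one for each path in
  \<open>S\<close>; taking paths extensional on \<open>{..m}\<close> makes the path of a cylinder
  unique.\<close>

lemma emeasure_srw_stays:
  assumes "finite S"
  shows "emeasure (srw G v) {\<omega>. \<forall>i\<le>m. \<omega> i \<in> S} =
         ennreal (indicator S v * (killed_step G S ^^ m) (\<lambda>_. 1) v)"
proof -
  let ?cyl = "\<lambda>x. {\<omega>. \<forall>i\<le>m. \<omega> i = x i}"
  let ?P = "{..m} \<rightarrow>\<^sub>E S"
  have fin: "finite ?P" using assms by (intro finite_PiE) auto
  have sets: "?cyl x \<in> sets (srw G v)" for x
  proof -
    have "{\<omega> \<in> space (srw G v). \<forall>i\<le>m. \<omega> i = x i} \<in> sets (srw G v)" by measurable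
    then show ?thesis by simp
  qed
  have disj: "disjoint_family_on ?cyl ?P"
    by (auto simp: disjoint_family_on_def PiE_iff extensional_def fun_eq_iff) metis
  have "{\<omega>. \<forall>i\<le>m. \<omega> i \<in> S} = (\<Union>x\<in>?P. ?cyl x)"
  proof (intro equalityI subsetI)
    fix \<omega> assume "\<omega> \<in> {\<omega>. \<forall>i\<le>m. \<omega> i \<in> S}"
    then show "\<omega> \<in> (\<Union>x\<in>?P. ?cyl x)"
      by (intro UN_I[of "restrict \<omega> {..m}"]) auto
  qed (auto simp: PiE_iff)
  then have "emeasure (srw G v) {\<omega>. \<forall>i\<le>m. \<omega> i \<in> S} = (\<Sum>x\<in>?P. emeasure (srw G v) (?cyl x))"
    using sets by (simp add: sum_emeasure[OF _ disj fin] image_subset_iff)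
  also have "\<dots> = (\<Sum>x\<in>?P. ennreal (indicator {v} (x 0) *
      (\<Prod>i<m. pmf (srw_step G (x i)) (x (Suc i))) * 1))"
    unfolding emeasure_srw_cylinder
    by (intro sum.cong refl)
      (simp add: ennreal_mult prod_nonneg flip: prod_ennreal ennreal_indicator)
  also have "\<dots> = ennreal (\<Sum>x\<in>?P. indicator {v} (x 0) *
      (\<Prod>i<m. pmf (srw_step G (x i)) (x (Suc i))) * 1)"
    by (intro sum_ennreal) (simp add: prod_nonneg)
  also have "\<dots> = ennreal (indicator S v * (killed_step G S ^^ m) (\<lambda>_. 1) v)"
    by (subst sum_paths_killed_step_pow[OF assms, where g = "\<lambda>_. 1"]) simp
  finally show ?thesis .
qed

text \<open>The last assumption covers two uses: \<open>S\<close> lacks only the target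
  \<open>u\<close>, where \<open>g u = 0\<close> makes the killed term vanish; or \<open>S\<close>
  is the whole vertex set and \<open>u\<close> is a dummy element of it.\<close>

lemma killed_step_eq_average:
  assumes "finite S" "neighbors G x \<noteq> {}" "neighbors G x \<subseteq> insert u S" "g u = 0 \<or> u \<in> S"
  shows "killed_step G S g x = (\<Sum>y\<in>neighbors G x. g y) / real (card (neighbors G x))"
proof -
  let ?N = "neighbors G x"
  have N: "finite ?N" using assms finite_subset by blast
  have "killed_step G S g x = (\<Sum>y\<in>insert u S. pmf (srw_step G x) y * g y)"
    unfolding killed_step_def using assms(1,4) by (intro sum.mono_neutral_left) auto
  also have "\<dots> = (\<Sum>y\<in>?N. pmf (srw_step G x) y * g y)"
    using assms N by (intro sum.mono_neutral_right) (auto simp: srw_step_def)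
  also have "\<dots> = (\<Sum>y\<in>?N. g y) / real (card ?N)"
    using assms(2) N by (auto simp: srw_step_def sum_divide_distrib intro!: sum.cong)
  finally show ?thesis .
qed

section \<open>Hitting times from first-step equations\<close>

lemma less_hitting_time_iff: "enat m < hitting_time u \<omega> \<longleftrightarrow> (\<forall>i\<le>m. \<omega> i \<noteq> u)"
proof
  assume less: "enat m < hitting_time u \<omega>"
  show "\<forall>i\<le>m. \<omega> i \<noteq> u"
  proof (intro allI impI notI)
    fix i assume "i \<le> m" "\<omega> i = u"
    then have "hitting_time u \<omega> \<le> enat i"
      unfolding hitting_time_def by (intro Inf_lower) auto
    with \<open>i \<le> m\<close> less show False by (meson enat_ord_simps(1) leD order_trans)
  qed
next
  assume avoid: "\<forall>i\<le>m. \<omega> i \<noteq> u"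
  \<comment> \<open>An infimum gives only a weak bound, hence the detour through
    \<open>Suc m\<close>; the empty set of visits is included.\<close>
  then have "enat (Suc m) \<le> hitting_time u \<omega>"
    unfolding hitting_time_def by (intro Inf_greatest) (auto simp: not_less_eq_eq[symmetric])
  then show "enat m < hitting_time u \<omega>"
    by (meson enat_ord_simps(2) lessI less_le_trans)
qed

text \<open>A finite nonnegative solution by itself forces the walk to reach \<open>u\<close> almost
  surely, so neither that nor uniqueness of the solution has to be proved beforehand.\<close>

lemma expected_hitting_time_eqI:
  fixes h :: "'a \<Rightarrow> real"
  assumes fin: "finite (fst G)" and v: "v \<in> fst G"
    and ne: "\<And>x. x \<in> fst G \<Longrightarrow> neighbors G x \<noteq> {}"
    and h_nonneg: "\<And>x. x \<in> fst G \<Longrightarrow> 0 \<le> h x"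
    and h_target: "h u = 0"
    and h_step: "\<And>x. x \<in> fst G \<Longrightarrow> x \<noteq> u \<Longrightarrow>
      h x = 1 + (\<Sum>y\<in>neighbors G x. h y) / real (card (neighbors G x))"
  shows "expected_hitting_time G v u = ennreal (h v)"
proof -
  interpret prob_space "srw G v" by (rule prob_space_srw)
  define S where "S = fst G - {u}"
  define L where "L = killed_step G S"
  \<comment> \<open>The indicator covers the start \<open>v = u\<close>: the hitting time is then 0,
    although the zeroth power gives 1.\<close>
  define p where "p m = indicator S v * (L ^^ m) (\<lambda>_. 1) v" for m
  have finS: "finite S" using fin by (simp add: S_def)
  have nbr: "neighbors G x \<subseteq> fst G" for x by (auto simp: neighbors_def)

  \<comment> \<open>Trajectories range over the whole type. Killing outside the vertex set loses no
    mass, so the walk almost surely stays among the vertices.\<close>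
  have conservative: "(killed_step G (fst G) ^^ m) (\<lambda>_. 1) x = 1" if "x \<in> fst G" for m x
    using that
  proof (induction m arbitrary: x)
    case (Suc m)
    have "killed_step G (fst G) ((killed_step G (fst G) ^^ m) (\<lambda>_. 1)) x
        = killed_step G (fst G) (\<lambda>_. 1) x"
      by (rule killed_step_cong) (rule Suc.IH)
    also have "\<dots> = 1"
      using nbr[of x] ne[OF Suc.prems] fin Suc.prems finite_subset[OF nbr fin, of x]
      by (subst killed_step_eq_average[where u = x]) auto
    finally show ?case by simp
  qed simp
  have in_V: "AE \<omega> in srw G v. \<forall>i\<le>m. \<omega> i \<in> fst G" for m
  proof -
    have "prob {\<omega>. \<forall>i\<le>m. \<omega> i \<in> fst G} = 1"
      using emeasure_srw_stays[OF fin, of G v m] conservative[OF v, of m] v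
      by (simp add: measure_def)
    from AE_prob_1[OF this] show ?thesis by simp
  qed
  \<comment> \<open>Avoiding \<open>u\<close> and staying in \<open>S\<close> differ only on the
    null event of leaving the vertex set.\<close>
  have p: "emeasure (srw G v) {\<omega> \<in> space (srw G v). enat m < hitting_time u \<omega>} = ennreal (p m)" for m
  proof -
    have "emeasure (srw G v) {\<omega>. enat m < hitting_time u \<omega>} = emeasure (srw G v) {\<omega>. \<forall>i\<le>m. \<omega> i \<in> S}"
    proof (rule emeasure_eq_AE)
      show "AE \<omega> in srw G v. (\<omega> \<in> {\<omega>. enat m < hitting_time u \<omega>}) = (\<omega> \<in> {\<omega>. \<forall>i\<le>m. \<omega> i \<in> S})"
        using in_V[of m] by eventually_elim (auto simp: less_hitting_time_iff S_def)
      show "{\<omega>. enat m < hitting_time u \<omega>} \<in> sets (srw G v)"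
        using sets_srw_stays[of m "-{u}" G v] by (simp add: less_hitting_time_iff)
    qed (rule sets_srw_stays)
    then show ?thesis by (simp add: emeasure_srw_stays[OF finS] p_def L_def)
  qed

  have Lh: "h x = 1 + L h x" if "x \<in> S" for x
    using that h_step[of x] ne[of x] nbr[of x] finS h_target
    by (subst L_def, subst killed_step_eq_average[where u = u]) (auto simp: S_def)
  have expand: "h x = (\<Sum>j<m. (L ^^ j) (\<lambda>_. 1) x) + (L ^^ m) h x" if "x \<in> S" for m x
    using that
  proof (induction m arbitrary: x)
    case (Suc m)
    have "h x = 1 + L h x" by (rule Lh[OF Suc.prems])
    \<comment> \<open>The induction hypothesis holds only on \<open>S\<close>, which suffices
      because \<open>L\<close> reads no other values.\<close>
    also have "L h x = L (\<lambda>y. (\<Sum>j<m. (L ^^ j) (\<lambda>_. 1) y) + (L ^^ m) h y) x"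
      unfolding L_def by (rule killed_step_cong) (rule Suc.IH[unfolded L_def])
    also have "\<dots> = (\<Sum>j<m. (L ^^ Suc j) (\<lambda>_. 1) x) + (L ^^ Suc m) h x"
      by (simp add: L_def killed_step_add killed_step_sum)
    finally show ?case by (subst sum.lessThan_Suc_shift) simp
  qed simp
  have p_nonneg: "0 \<le> p m" for m
    using killed_step_pow_nonneg[of v S "\<lambda>_. 1" m G] by (auto simp: p_def L_def indicator_def)
  have "p sums h v"
  proof (cases "v \<in> S")
    case False
    then have "p = (\<lambda>_. 0)" "v = u" using v by (auto simp: p_def S_def)
    then show ?thesis using h_target by simp
  next
    case True
    define r where "r m = (L ^^ m) h v" for m
    have hv: "h v = (\<Sum>j<m. p j) + r m" for m
      using expand[OF True, of m] True by (simp add: p_def r_def)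
    have r_nonneg: "0 \<le> r m" for m
      unfolding r_def L_def using True h_nonneg by (intro killed_step_pow_nonneg) (auto simp: S_def)
    \<comment> \<open>The sum of \<open>h\<close> over the finite set \<open>S\<close> is a
      convenient upper bound for its values there.\<close>
    have r_le: "r m \<le> (\<Sum>y\<in>S. h y) * p m" for m
    proof -
      have "h y \<le> (\<Sum>y\<in>S. h y)" if "y \<in> S" for y
        using that finS h_nonneg by (intro member_le_sum) (auto simp: S_def)
      from killed_step_pow_le[OF True this] show ?thesis
        using True by (simp add: r_def p_def L_def)
    qed
    have "summable p"
      using hv r_nonneg by (intro summableI_nonneg_bounded[where x = "h v"] p_nonneg) (smt (verit))
    then have lim: "(\<lambda>m. (\<Sum>y\<in>S. h y) * p m) \<longlonglongrightarrow> 0"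
      by (intro tendsto_mult_right_zero summable_LIMSEQ_zero)
    have "r \<longlonglongrightarrow> 0"
      by (rule tendsto_sandwich[OF _ _ tendsto_const lim]) (use r_nonneg r_le in auto)
    then have "(\<lambda>m. h v - r m) \<longlonglongrightarrow> h v - 0"
      by (intro tendsto_intros)
    moreover have "(\<lambda>m. h v - r m) = (\<lambda>m. \<Sum>j<m. p j)" using hv by (auto simp: algebra_simps)
    ultimately show ?thesis by (simp add: sums_def)
  qed
  moreover have "hitting_time u \<in> measurable (srw G v) (count_space UNIV)"
  \<comment> \<open>Singletons suffice in the countable type \<open>enat\<close>, and injectivity of
    \<open>ennreal_of_enat\<close> turns their preimages into those of a measurable map.\<close>
  proof (rule measurable_count_space_eq_countable[OF countableI_type, THEN iffD2], intro conjI ballI)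
    fix a :: enat
    have "hitting_time u -` {a} \<inter> space (srw G v) =
        (\<lambda>\<omega>. ennreal_of_enat (hitting_time u \<omega>)) -` {ennreal_of_enat a} \<inter> space (srw G v)"
      by auto
    also have "\<dots> \<in> sets (srw G v)"
      by (rule measurable_sets[OF measurable_hitting_time]) auto
    finally show "hitting_time u -` {a} \<inter> space (srw G v) \<in> sets (srw G v)" .
  qed simp
  \<comment> \<open>Tail-sum formula: the expectation is the sum over \<open>m\<close> of the
    probabilities of exceeding \<open>m\<close>.\<close>
  then have "expected_hitting_time G v u = (\<Sum>m. ennreal (p m))"
    unfolding expected_hitting_time_def using nn_integral_enat_function[of "hitting_time u" "srw G v"] p
    by simp
  ultimately show ?thesis
    using p_nonneg by (simp add: suminf_ennreal_eq sums_iff)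
qed

section \<open>Adjacency in the tree\<close>

lemma pendant_path_tree_vertices:
  "fst (pendant_path_tree n k c) = V ` {1..n} \<union> U ` {1..c}"
  by (simp add: pendant_path_tree_def)

lemma in_pendant_path_tree_vertices [simp]:
  "V i \<in> fst (pendant_path_tree n k c) \<longleftrightarrow> 1 \<le> i \<and> i \<le> n"
  "U j \<in> fst (pendant_path_tree n k c) \<longleftrightarrow> 1 \<le> j \<and> j \<le> c"
  by (auto simp: pendant_path_tree_vertices)

lemma pendant_path_tree_edges [simp]:
  "{V i, V j} \<in> snd (pendant_path_tree n k c) \<longleftrightarrow>
     (1 \<le> i \<and> i < n \<and> j = i + 1) \<or> (1 \<le> j \<and> j < n \<and> i = j + 1)"
  "{U i, U j} \<in> snd (pendant_path_tree n k c) \<longleftrightarrow>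
     (1 \<le> i \<and> i < c \<and> j = i + 1) \<or> (1 \<le> j \<and> j < c \<and> i = j + 1)"
  "{V i, U j} \<in> snd (pendant_path_tree n k c) \<longleftrightarrow> i = k \<and> j = c"
  "{U j, V i} \<in> snd (pendant_path_tree n k c) \<longleftrightarrow> i = k \<and> j = c"
  by (auto simp: pendant_path_tree_def doubleton_eq_iff)

lemma neighbors_pendant_path_tree_V:
  assumes "1 \<le> i" "i \<le> n" "1 \<le> c"
  shows "neighbors (pendant_path_tree n k c) (V i) = (if 1 < i then {V (i - 1)} else {}) \<union>
      (if i < n then {V (i + 1)} else {}) \<union> (if i = k then {U c} else {})"
proof (rule set_eqI)
  fix y show "y \<in> neighbors (pendant_path_tree n k c) (V i) \<longleftrightarrow> y \<in> (if 1 < i then {V (i - 1)} else {}) \<union>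
      (if i < n then {V (i + 1)} else {}) \<union> (if i = k then {U c} else {})"
    using assms by (cases y) (auto simp: neighbors_def)
qed

lemma neighbors_pendant_path_tree_U:
  assumes "1 \<le> j" "j \<le> c" "1 \<le> k" "k \<le> n"
  shows "neighbors (pendant_path_tree n k c) (U j) = (if 1 < j then {U (j - 1)} else {}) \<union>
      {if j < c then U (j + 1) else V k}"
proof (rule set_eqI)
  fix y show "y \<in> neighbors (pendant_path_tree n k c) (U j) \<longleftrightarrow> y \<in> (if 1 < j then {U (j - 1)} else {}) \<union>
      {if j < c then U (j + 1) else V k}"
    using assms by (cases y) (auto simp: neighbors_def)
qed

section \<open>The explicit solution and its first-step equations\<close>

theorem theorem6:
  fixes n k c :: nat and t :: "nat \<Rightarrow> ennreal"
  assumes "n \<ge> 3" and "2 \<le> k" and "k \<le> n - 1" and "c \<ge> 1"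
    and t: "\<And>i. t i = expected_hitting_time (pendant_path_tree n k c) (V i) (V n)"
  shows "(\<forall>i. 1 \<le> i \<and> i \<le> k - 1 \<longrightarrow>
           t i = ennreal ((real n)\<^sup>2 - (real k)\<^sup>2 + 2 * (real c - 1) * (real n - real k)
                          + (real k - 1)\<^sup>2 - (real i - 1)\<^sup>2)) \<and>
         (\<forall>i. k \<le> i \<and> i \<le> n - 1 \<longrightarrow>
           t i = ennreal ((real n)\<^sup>2 - (real i)\<^sup>2 + 2 * (real c - 1) * (real n - real i)))"
proof -
  let ?G = "pendant_path_tree n k c"
  \<comment> \<open>The second formula is extended to \<open>i = n\<close>, where it is 0; the two
    formulas agree at \<open>i = k\<close>.\<close>
  define hV where "hV i = (if i < k
      then (real n)\<^sup>2 - (real k)\<^sup>2 + 2 * (real c - 1) * (real n - real k)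
        + (real k - 1)\<^sup>2 - (real i - 1)\<^sup>2
      else (real n)\<^sup>2 - (real i)\<^sup>2 + 2 * (real c - 1) * (real n - real i))" for i
  \<comment> \<open>Stepping onward from \<open>U i\<close> for the first time takes
    \<open>2 * i - 1\<close> steps on average; summing over \<open>i\<close> from \<open>j\<close>
    to \<open>c\<close> gives \<open>c^2 - (j - 1)^2\<close> steps to reach
    \<open>V k\<close>.\<close>
  define hU where "hU j = hV k + (real c)\<^sup>2 - (real j - 1)\<^sup>2" for j
  define h where "h x = (case x of V i \<Rightarrow> hV i | U j \<Rightarrow> hU j)" for x
  have h_simps [simp]: "h (V i) = hV i" "h (U j) = hU j" for i j
    by (simp_all add: h_def)
  have kn: "k < n" using assms by simp
  have nbr_V: "neighbors ?G (V i) = (if 1 < i then {V (i - 1)} else {}) \<union>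
      (if i < n then {V (i + 1)} else {}) \<union> (if i = k then {U c} else {})" if "1 \<le> i" "i \<le> n" for i
    using that assms(4) by (rule neighbors_pendant_path_tree_V)
  have nbr_U: "neighbors ?G (U j) = (if 1 < j then {U (j - 1)} else {}) \<union>
      {if j < c then U (j + 1) else V k}" if "1 \<le> j" "j \<le> c" for j
    using that kn assms(2) by (intro neighbors_pendant_path_tree_U) auto
  have main: "expected_hitting_time ?G (V i) (V n) = ennreal (h (V i))" if "1 \<le> i" "i \<le> n" for i
  proof (rule expected_hitting_time_eqI)
    show "finite (fst ?G)" by (simp add: pendant_path_tree_vertices)
    show "V i \<in> fst ?G" using that by simp
    show "neighbors ?G x \<noteq> {}" if "x \<in> fst ?G" for x
    proof (cases x)
      case (V i)
      then show ?thesis using that assms(1) by (cases "i < n") (auto simp: nbr_V)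
    qed (use that in \<open>simp add: nbr_U\<close>)
    show "h (V n) = 0" using kn by (simp add: hV_def)
    have ge: "0 \<le> hV i" if "k \<le> i" "i \<le> n" for i
    proof -
      have "(real i)\<^sup>2 \<le> (real n)\<^sup>2" "0 \<le> 2 * (real c - 1) * (real n - real i)"
        using that assms(4) by (auto intro!: power_mono mult_nonneg_nonneg)
      then show ?thesis using that by (simp add: hV_def)
    qed
    show "0 \<le> h x" if "x \<in> fst ?G" for x
    proof (cases x)
      case (V i)
      show ?thesis
      proof (cases "i < k")
        case True
        then have "(real i - 1)\<^sup>2 \<le> (real k - 1)\<^sup>2"
          using V that by (intro power_mono) auto
        then show ?thesis using ge[of k] V True kn by (simp add: hV_def)
      qed (use V that ge in simp)
    next
      case (U j)
      have "(real j - 1)\<^sup>2 \<le> (real c)\<^sup>2"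
        using U that by (intro power_mono) auto
      then show ?thesis using ge[of k] U kn by (simp add: hU_def)
    qed
    show "h x = 1 + (\<Sum>y\<in>neighbors ?G x. h y) / real (card (neighbors ?G x))"
      if "x \<in> fst ?G" "x \<noteq> V n" for x
    proof (cases x)
      case (V i)
      then have i: "1 \<le> i" "i < n" using that by auto
      consider "i = 1" | m where "i = Suc m" "1 \<le> m" using i by (cases i) force+
      then show ?thesis
      proof cases
        case 1
        then have N: "neighbors ?G x = {V 2}" using V i assms(2) by (simp add: nbr_V numeral_2_eq_2)
        have "hV 1 = 1 + hV 2"
          \<comment> \<open>For \<open>k = 2\<close> the neighbor \<open>V 2\<close> is the branch
            vertex and uses the second formula.\<close>
          using assms(2) by (cases "k = 2") (simp_all add: hV_def power2_eq_square algebra_simps)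
        then show ?thesis using V 1 N by simp
      next
        case (2 m)
        have N: "neighbors ?G x = (if i = k then {V m, V (Suc (Suc m)), U c} else {V m, V (Suc (Suc m))})"
          using V i 2 by (auto simp: nbr_V)
        show ?thesis
        proof (cases "i = k")
          case True
          \<comment> \<open>The first-step equation times the degree 3. The differences to
            \<open>hV k\<close> are \<open>2 * k - 3\<close>, \<open>- (2 * k + 2 * c - 1)\<close>
            and \<open>2 * c - 1\<close>, with sum -3.\<close>
          have "3 * hV k = 3 + hV m + hV (Suc (Suc m)) + hU c"
            unfolding hV_def hU_def using True[symmetric] 2
            by (simp add: power2_eq_square algebra_simps)
          then show ?thesis using V 2 True N by (simp add: field_simps)
        next
          case False
          have "2 * hV i = 2 + hV m + hV (Suc (Suc m))"
          \<comment> \<open>Only here do the three vertices straddle the two formulas: the right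
            neighbor is \<open>V k\<close>. Otherwise all three use the same one.\<close>
          proof (cases "Suc i = k")
            case True
            then show ?thesis
              unfolding hV_def using True[symmetric] 2 by (simp add: power2_eq_square algebra_simps)
          next
            case False
            with \<open>i \<noteq> k\<close> 2 show ?thesis
              by (cases "i < k") (simp_all add: hV_def power2_eq_square algebra_simps)
          qed
          then show ?thesis using V 2 False N by (simp add: field_simps)
        qed
      qed
    next
      case (U j)
      then have j: "1 \<le> j" "j \<le> c" using that by auto
      \<comment> \<open>The formula of \<open>hU\<close> continued to \<open>c + 1\<close> equals
        \<open>hV k\<close>, so one expression serves both the pendant path and its junction with
        the spine.\<close>
      define next_u where "next_u = (if j < c then U (Suc j) else V k)"
      have next_u: "h next_u = hV k + (real c)\<^sup>2 - (real j)\<^sup>2"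
        using j by (simp add: next_u_def hU_def)
      consider "j = 1" | m where "j = Suc m" "1 \<le> m" using j by (cases j) force+
      then show ?thesis
      proof cases
        case 1
        then have N: "neighbors ?G x = {next_u}" using U j by (simp add: nbr_U next_u_def)
        then show ?thesis using U 1 next_u by (simp add: hU_def)
      next
        case (2 m)
        then have N: "neighbors ?G x = {U m, next_u}" "U m \<noteq> next_u"
          using U j by (auto simp: nbr_U next_u_def)
        have "2 * hU j = 2 + hU m + h next_u"
          unfolding next_u using 2 by (simp add: hU_def power2_eq_square algebra_simps)
        then show ?thesis using U N by (simp add: field_simps)
      qed
    qed
  qed
  show ?thesis
    using assms(1,2,3) kn by (auto simp: t main hV_def)
qed

end
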